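(* Consider $y''+p_1(x)y'+p_2(x)y=q(x)$ with $q(x)\neq 0$, and let $y_1(x),y_2(x)$ be linearly independent solutions of the corresponding homogeneous equation. Take the particular solution in the form $y_p(x)=c_1(x)y_1(x)+c_2(x)y_2(x)$. If, instead of imposing $c_1'(x)y_1(x)+c_2'(x)y_2(x)=0$, one chooses $$c_1'(x)y_1(x)+c_2'(x)y_2(x)=A(x),$$ where $A(x)$ is an arbitrary constant or, more generally, an arbitrarily selected differentiable function, so that the differential equation becomes $$y_1'(x)c_1'(x)+y_2'(x)c_2'(x)=q(x)-\bigl(A'(x)+p_1(x)A(x)\bigr),$$ then one can still determine the unknown functions $c_1(x)$ and $c_2(x)$ and get the same solution $y(x)$. Namely, solving gives $$c_1'(x)=\frac{\bigl(q(x)-A'(x)-p_1(x)A(x)\bigr)y_2(x)-A(x)y_2'(x)}{W(y_1(x),y_2(x))},$$ $$c_2'(x)=\frac{\bigl(q(x)-A'(x)-p_1(x)A(x)\bigr)y_1(x)-A(x)y_1'(x)}{-W(y_1(x),y_2(x))},$$ and, on integrating, the particular solution is $$y_p(x)=\int K(x,s)\,q(s)\,ds-\int K(x,s)\,A'(s)\,ds-\int K(x,s)\,p_1(s)A(s)\,ds-\int\frac{y_1(x)y_2'(s)-y_2(x)y_1'(s)}{W(y_1(s),y_2(s))}A(s)\,ds,$$ where $$K(x,s)=\frac{y_1(x)y_2(s)-y_2(x)y_1(s)}{W(y_1(s),y_2(s))}.$$ The total contribution of the integral terms depending on $A$ and $A'$ to the particular integral is zero, and the complete solution of the equation is, whatever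 the choice of $A$, $$y(x)=c_1y_1(x)+c_2y_2(x)+\int\frac{y_1(x)y_2(s)-y_2(x)y_1(s)}{W(y_1(s),y_2(s))}\,q(s)\,ds,$$ where in this last formula $c_1,c_2$ are arbitrary constants.
   Context: $W(y_1(x),y_2(x))=y_1(x)y_2'(x)-y_1'(x)y_2(x)$ is the Wronskian. The integrals are indefinite integrals in $s$: they come from $c_i(x)=\int c_i'(x)\,dx$, with the factors $y_1(x),y_2(x)$ outside the integration. A particular integral of a linear nonhomogeneous ODE is a function satisfying that ODE and not satisfying the corresponding homogeneous ODE. The conventional method of variation of parameters is the case $A\equiv 0$.
   Formalization: With W = y1 y2' − y1' y2 the printed formulas have the wrong sign (y''=1, y1=1, y2=x gives −x²/2); W is replaced by −W in c1', c2', K, y_p and the complete solution. Also p1, p2, q are assumed continuous on an open interval, so that W is nonzero and the integrals exist. *)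

theory Defs
  imports "HOL-Analysis.Analysis"
begin

definition wronskian :: "(real \<Rightarrow> real) \<Rightarrow> (real \<Rightarrow> real) \<Rightarrow> real \<Rightarrow> real" where
  "wronskian y1 y2 x = y1 x * deriv y2 x - deriv y1 x * y2 x"

(* y'' + p1 y' + p2 y = q on I; meant for open I, where differentiability within I and at a
   point agree. *)
definition solves_ode2 ::
  "real set \<Rightarrow> (real \<Rightarrow> real) \<Rightarrow> (real \<Rightarrow> real) \<Rightarrow> (real \<Rightarrow> real) \<Rightarrow> (real \<Rightarrow> real) \<Rightarrow> bool" where
  "solves_ode2 I p1 p2 q y \<longleftrightarrow>
     y differentiable_on I \<and> deriv y differentiable_on I \<and>
     (\<forall>x\<in>I. deriv (deriv y) x + p1 x * deriv y x + p2 x * y x = q x)"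

definition particular_integral ::
  "real set \<Rightarrow> (real \<Rightarrow> real) \<Rightarrow> (real \<Rightarrow> real) \<Rightarrow> (real \<Rightarrow> real) \<Rightarrow> (real \<Rightarrow> real) \<Rightarrow> bool" where
  "particular_integral I p1 p2 q y \<longleftrightarrow>
     solves_ode2 I p1 p2 q y \<and> \<not> solves_ode2 I p1 p2 (\<lambda>_. 0) y"

definition lin_indep_on :: "real set \<Rightarrow> (real \<Rightarrow> real) \<Rightarrow> (real \<Rightarrow> real) \<Rightarrow> bool" where
  "lin_indep_on I y1 y2 \<longleftrightarrow>
     (\<forall>a b. (\<forall>x\<in>I. a * y1 x + b * y2 x = 0) \<longrightarrow> a = 0 \<and> b = 0)"

definition antiderivative_on :: "real set \<Rightarrow> (real \<Rightarrow> real) \<Rightarrow> (real \<Rightarrow> real) \<Rightarrow> bool" where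
  "antiderivative_on I f F \<longleftrightarrow> (\<forall>x\<in>I. (F has_real_derivative f x) (at x))"

(* J(x) is a value of the indefinite integral of k(x,s) ds, taken in s with the factors y1(x)
   and y2(x) outside the integration: if k(x,s) = y1(x) f(s) + y2(x) g(s), then
   J(x) = y1(x) F(x) + y2(x) G(x) with antiderivatives F of f and G of g.  For linearly
   independent y1, y2 the functions f and g are determined by k, so J is determined up to
   adding a y1 + b y2 with constants of integration a, b. *)
definition indef_integral ::
  "real set \<Rightarrow> (real \<Rightarrow> real) \<Rightarrow> (real \<Rightarrow> real) \<Rightarrow> (real \<Rightarrow> real \<Rightarrow> real) \<Rightarrow> (real \<Rightarrow> real) \<Rightarrow> bool" where
  "indef_integral I y1 y2 k J \<longleftrightarrow>
     (\<exists>f g F G. (\<forall>x\<in>I. \<forall>s\<in>I. k x s = y1 x * f s + y2 x * g s) \<and>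
        antiderivative_on I f F \<and> antiderivative_on I g G \<and>
        (\<forall>x\<in>I. J x = y1 x * F x + y2 x * G x))"

(* Sign: the source prints the denominator W here and in vp_kernel_A, and in c1' and c2' it
   prints W and -W.  With W = y1 y2' - y1' y2 every such W has to be -W.  Otherwise, for
   y'' = 1 with y1 = 1, y2 = x, W = 1, the kernel would be s - x, whose integral in s is
   -x^2/2 at s = x, and that solves y'' = -1. *)
definition vp_kernel :: "(real \<Rightarrow> real) \<Rightarrow> (real \<Rightarrow> real) \<Rightarrow> real \<Rightarrow> real \<Rightarrow> real" where
  "vp_kernel y1 y2 x s = (y1 x * y2 s - y2 x * y1 s) / (- wronskian y1 y2 s)"

definition vp_kernel_A :: "(real \<Rightarrow> real) \<Rightarrow> (real \<Rightarrow> real) \<Rightarrow> real \<Rightarrow> real \<Rightarrow> real" where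
  "vp_kernel_A y1 y2 x s = (y1 x * deriv y2 s - y2 x * deriv y1 s) / (- wronskian y1 y2 s)"

definition vp_coeffs ::
  "real set \<Rightarrow> (real \<Rightarrow> real) \<Rightarrow> (real \<Rightarrow> real) \<Rightarrow> (real \<Rightarrow> real) \<Rightarrow> (real \<Rightarrow> real) \<Rightarrow> (real \<Rightarrow> real) \<Rightarrow>
     (real \<Rightarrow> real) \<Rightarrow> (real \<Rightarrow> real) \<Rightarrow> bool" where
  "vp_coeffs I p1 q y1 y2 A c1 c2 \<longleftrightarrow>
     c1 differentiable_on I \<and> c2 differentiable_on I \<and>
     (\<forall>x\<in>I. deriv c1 x * y1 x + deriv c2 x * y2 x = A x \<and>
        deriv y1 x * deriv c1 x + deriv y2 x * deriv c2 x = q x - (deriv A x + p1 x * A x))"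

end

theory Submission
  imports Defs
begin

text \<open>
  Write \<open>W\<close> for the Wronskian.  Abel's identity \<open>W' = - p1 W\<close> gives
  \<open>(y / W)' = (y' + p1 y) / W\<close> for every homogeneous solution \<open>y\<close>, hence
  \<open>(y / W A)' = y / W A' + y / W p1 A + y' / W A\<close>.  The right-hand side is exactly the group of
  terms that \<open>A\<close> adds to \<open>c1'\<close> (for \<open>y = y2\<close>) and, up to sign, to \<open>c2'\<close> (for \<open>y = y1\<close>).
  So a nonzero \<open>A\<close> shifts \<open>c1\<close> by \<open>y2 / W A\<close> and \<open>c2\<close> by \<open>- y1 / W A\<close>, and these shifts
  cancel in \<open>c1 y1 + c2 y2\<close>.  Lemma \<open>vp_coeffs_iff_antiderivatives\<close> is the shift, and
  \<open>vp_solution_iff_indef_integral\<close> concludes that for every \<open>A\<close> the functions obtained are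
  precisely the indefinite integrals of the kernel against \<open>q\<close>.  The same identity shows in
  \<open>A_terms_zero_exists\<close> and \<open>A_terms_homogeneous\<close> that the three integrals containing \<open>A\<close>
  cancel up to the constants of integration, which contribute a homogeneous solution.

  That \<open>W\<close> has no zero and that \<open>y1\<close>, \<open>y2\<close> span the homogeneous solutions both come from
  uniqueness for zero initial values (\<open>homogeneous_zero_initial_values\<close>), proved by a Gronwall
  estimate.
\<close>

section \<open>Antiderivatives on an open interval\<close>

lemma antiderivative_on_iff_deriv:
  assumes "open I"
  shows "antiderivative_on I f F \<longleftrightarrow> F differentiable_on I \<and> (\<forall>x\<in>I. deriv F x = f x)"
  unfolding antiderivative_on_def differentiable_on_eq_differentiable_at[OF assms]
  using DERIV_deriv_iff_real_differentiable DERIV_imp_deriv real_differentiable_def by metis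

text \<open>An open interval, bounded or not, consists of the reals strictly between its infimum and its
  supremum taken in the extended reals; this reduces the claim to integration between extended
  real endpoints.\<close>

lemma antiderivative_on_exists:
  fixes f :: "real \<Rightarrow> real"
  assumes "open I" "is_interval I" "continuous_on I f"
  shows "\<exists>F. antiderivative_on I f F"
proof (cases "I = {}")
  case True
  then show ?thesis by (simp add: antiderivative_on_def)
next
  case False
  define a where "a = Inf (ereal ` I)"
  define b where "b = Sup (ereal ` I)"
  have inside: "a < ereal x \<and> ereal x < b" if "x \<in> I" for x
  proof -
    obtain e where e: "e > 0" "ball x e \<subseteq> I"
      using assms(1) \<open>x \<in> I\<close> open_contains_ball by blast
    have "x - e/2 \<in> I" "x + e/2 \<in> I"
      using e by (auto simp: subset_iff dist_real_def)
    then have "a \<le> ereal (x - e/2)" "ereal (x + e/2) \<le> b"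
      unfolding a_def b_def by (auto intro: Inf_lower Sup_upper)
    moreover have "ereal (x - e/2) < ereal x" "ereal x < ereal (x + e/2)" using e by auto
    ultimately show ?thesis by (meson le_less_trans less_le_trans)
  qed
  have mem: "x \<in> I" if x: "a < ereal x" "ereal x < b" for x
  proof -
    obtain l u where "l \<in> I" "u \<in> I" "l < x" "x < u"
      using x unfolding a_def b_def by (auto simp: Inf_less_iff less_Sup_iff)
    then show ?thesis using assms(2) unfolding is_interval_1 by (meson less_imp_le)
  qed
  have "a < b" using False inside by (meson ex_in_conv less_trans)
  moreover have "isCont f x" if "a < ereal x" "ereal x < b" for x
    using assms(1,3) mem[OF that] continuous_on_eq_continuous_at by blast
  ultimately obtain F where
    "\<And>x. a < ereal x \<Longrightarrow> ereal x < b \<Longrightarrow> (F has_vector_derivative f x) (at x)"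
    using einterval_antiderivative[of a b f] by blast
  then show ?thesis
    using inside unfolding antiderivative_on_def has_real_derivative_iff_has_vector_derivative
    by blast
qed

lemma antiderivative_on_diff_const:
  assumes "is_interval I" "antiderivative_on I f F" "antiderivative_on I f G"
  shows "\<exists>c. \<forall>x\<in>I. F x = G x + c"
proof -
  have "((\<lambda>x. F x - G x) has_real_derivative 0) (at x within I)" if "x \<in> I" for x
    using assms(2,3) that unfolding antiderivative_on_def
    by (auto intro!: derivative_eq_intros intro: has_field_derivative_at_within)
  then obtain c where "\<And>x. x \<in> I \<Longrightarrow> F x - G x = c"
    using has_field_derivative_zero_constant[of I "\<lambda>x. F x - G x"] assms(1) is_interval_convex
    by blast
  then show ?thesis by (metis add.commute diff_add_cancel)
qed

lemma antiderivative_on_add: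
  assumes "antiderivative_on I f F" "antiderivative_on I g G"
  shows "antiderivative_on I (\<lambda>x. f x + g x) (\<lambda>x. F x + G x)"
  using assms unfolding antiderivative_on_def by (auto intro!: derivative_intros)

lemma antiderivative_on_diff:
  assumes "antiderivative_on I f F" "antiderivative_on I g G"
  shows "antiderivative_on I (\<lambda>x. f x - g x) (\<lambda>x. F x - G x)"
  using assms unfolding antiderivative_on_def by (auto intro!: derivative_intros)

lemma antiderivative_on_add_const:
  assumes "antiderivative_on I f F"
  shows "antiderivative_on I f (\<lambda>x. F x + c)"
  using assms unfolding antiderivative_on_def by (auto intro!: derivative_eq_intros)

lemma antiderivative_on_cong:
  assumes "\<And>x. x \<in> I \<Longrightarrow> f x = g x" "antiderivative_on I f F"
  shows "antiderivative_on I g F"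
  using assms unfolding antiderivative_on_def by auto

text \<open>With an antiderivative \<open>K\<close> of \<open>k\<close>, the function \<open>E exp (-K)\<close> is nonincreasing and
  \<open>E exp K\<close> is nondecreasing.  The first controls \<open>E\<close> to the right of \<open>x0\<close>, the second to the
  left.  Since \<open>K\<close> lives on all of \<open>I\<close>, there is no reduction to compact subintervals.\<close>

lemma Gronwall_zero:
  fixes E :: "real \<Rightarrow> real"
  assumes I: "open I" "is_interval I" and k: "continuous_on I k"
    and E: "\<And>x. x \<in> I \<Longrightarrow> (E has_real_derivative E' x) (at x)"
    and bound: "\<And>x. x \<in> I \<Longrightarrow> \<bar>E' x\<bar> \<le> k x * E x"
    and nonneg: "\<And>x. x \<in> I \<Longrightarrow> 0 \<le> E x"
    and x0: "x0 \<in> I" "E x0 = 0" and x: "x \<in> I"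
  shows "E x = 0"
proof -
  obtain K where K: "\<And>x. x \<in> I \<Longrightarrow> (K has_real_derivative k x) (at x)"
    using antiderivative_on_exists[OF I k] unfolding antiderivative_on_def by blast
  have sub: "t \<in> I" if "l \<in> I" "u \<in> I" "l \<le> t" "t \<le> u" for l u t
    using I(2) that unfolding is_interval_1 by blast
  have "E x \<le> 0"
  proof (cases "x0 \<le> x")
    case True
    have "E x * exp (- K x) \<le> E x0 * exp (- K x0)"
    proof (rule DERIV_nonpos_imp_nonincreasing[OF True])
      fix t assume "x0 \<le> t" "t \<le> x"
      then have t: "t \<in> I" using sub x0(1) x by blast
      have "((\<lambda>x. E x * exp (- K x)) has_real_derivative (E' t - k t * E t) * exp (- K t)) (at t)"
        by (auto intro!: derivative_eq_intros E[OF t] K[OF t] simp: algebra_simps)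
      moreover have "(E' t - k t * E t) * exp (- K t) \<le> 0"
        using bound[OF t] by (intro mult_nonpos_nonneg) auto
      ultimately show "\<exists>y. ((\<lambda>x. E x * exp (- K x)) has_real_derivative y) (at t) \<and> y \<le> 0" by blast
    qed
    then show ?thesis using x0 by (simp add: mult_le_0_iff)
  next
    case False
    then have "x \<le> x0" by simp
    have "E x * exp (K x) \<le> E x0 * exp (K x0)"
    proof (rule DERIV_nonneg_imp_nondecreasing[OF \<open>x \<le> x0\<close>])
      fix t assume "x \<le> t" "t \<le> x0"
      then have t: "t \<in> I" using sub x0(1) x by blast
      have "((\<lambda>x. E x * exp (K x)) has_real_derivative (E' t + k t * E t) * exp (K t)) (at t)"
        by (auto intro!: derivative_eq_intros E[OF t] K[OF t] simp: algebra_simps)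
      moreover have "(E' t + k t * E t) * exp (K t) \<ge> 0"
        using bound[OF t] by (intro mult_nonneg_nonneg) auto
      ultimately show "\<exists>y. ((\<lambda>x. E x * exp (K x)) has_real_derivative y) (at t) \<and> y \<ge> 0" by blast
    qed
    then show ?thesis using x0 by (simp add: mult_le_0_iff)
  qed
  then show ?thesis using nonneg[OF x] by simp
qed

section \<open>Second-order linear equations\<close>

lemma solves_ode2_iff:
  assumes "open I"
  shows "solves_ode2 I p1 p2 q y \<longleftrightarrow>
    (\<exists>d e. \<forall>x\<in>I. (y has_real_derivative d x) (at x) \<and> (d has_real_derivative e x) (at x) \<and>
       e x + p1 x * d x + p2 x * y x = q x)" (is "?L \<longleftrightarrow> ?R")
proof
  assume ?L
  then have "\<forall>x\<in>I. (y has_real_derivative deriv y x) (at x) \<and>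
      (deriv y has_real_derivative deriv (deriv y) x) (at x) \<and>
      deriv (deriv y) x + p1 x * deriv y x + p2 x * y x = q x"
    unfolding solves_ode2_def differentiable_on_eq_differentiable_at[OF assms]
    using DERIV_deriv_iff_real_differentiable by blast
  then show ?R by blast
next
  assume ?R
  then obtain d e where d: "\<And>x. x \<in> I \<Longrightarrow> (y has_real_derivative d x) (at x)"
    and e: "\<And>x. x \<in> I \<Longrightarrow> (d has_real_derivative e x) (at x)"
    and eq: "\<And>x. x \<in> I \<Longrightarrow> e x + p1 x * d x + p2 x * y x = q x" by blast
  have dy: "deriv y x = d x" if "x \<in> I" for x using d[OF that] by (rule DERIV_imp_deriv)
  have ddy: "(deriv y has_real_derivative e x) (at x)" if "x \<in> I" for x
    using has_field_derivative_transform_within_open[OF e[OF that] assms that] dy by auto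
  show ?L
    unfolding solves_ode2_def differentiable_on_eq_differentiable_at[OF assms]
    using d ddy eq dy DERIV_imp_deriv[OF ddy] real_differentiable_def by auto
qed

lemma solves_ode2_derivs:
  assumes "open I" "solves_ode2 I p1 p2 q y" "x \<in> I"
  shows "(y has_real_derivative deriv y x) (at x)"
    and "(deriv y has_real_derivative q x - p1 x * deriv y x - p2 x * y x) (at x)"
proof -
  show "(y has_real_derivative deriv y x) (at x)"
    using assms unfolding solves_ode2_def differentiable_on_eq_differentiable_at[OF assms(1)]
    by (simp add: DERIV_deriv_iff_real_differentiable)
  have "deriv (deriv y) x = q x - p1 x * deriv y x - p2 x * y x"
    using assms unfolding solves_ode2_def by (auto simp: algebra_simps)
  moreover have "(deriv y has_real_derivative deriv (deriv y) x) (at x)"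
    using assms unfolding solves_ode2_def differentiable_on_eq_differentiable_at[OF assms(1)]
    by (simp add: DERIV_deriv_iff_real_differentiable)
  ultimately show "(deriv y has_real_derivative q x - p1 x * deriv y x - p2 x * y x) (at x)"
    by simp
qed

lemma solves_ode2_cong:
  assumes "open I" "\<And>x. x \<in> I \<Longrightarrow> y x = z x" "\<And>x. x \<in> I \<Longrightarrow> q x = r x"
    and "solves_ode2 I p1 p2 q y"
  shows "solves_ode2 I p1 p2 r z"
  unfolding solves_ode2_iff[OF assms(1)]
proof (intro exI ballI conjI)
  fix x assume x: "x \<in> I"
  show "(z has_real_derivative deriv y x) (at x)"
    using has_field_derivative_transform_within_open
      [OF solves_ode2_derivs(1)[OF assms(1,4) x] assms(1) x] assms(2) by auto
  show "(deriv y has_real_derivative q x - p1 x * deriv y x - p2 x * y x) (at x)"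
    by (rule solves_ode2_derivs(2)[OF assms(1,4) x])
  show "(q x - p1 x * deriv y x - p2 x * y x) + p1 x * deriv y x + p2 x * z x = r x"
    using assms(2,3) x by simp
qed

lemma solves_ode2_lincomb:
  assumes "open I" "solves_ode2 I p1 p2 q y" "solves_ode2 I p1 p2 r z"
  shows "solves_ode2 I p1 p2 (\<lambda>x. a * q x + b * r x) (\<lambda>x. a * y x + b * z x)"
  unfolding solves_ode2_iff[OF assms(1)]
proof (intro exI ballI conjI)
  fix x assume x: "x \<in> I"
  note D = solves_ode2_derivs[OF assms(1,2) x] solves_ode2_derivs[OF assms(1,3) x]
  show "((\<lambda>x. a * y x + b * z x) has_real_derivative a * deriv y x + b * deriv z x) (at x)"
    by (auto intro!: derivative_eq_intros D)
  show "((\<lambda>x. a * deriv y x + b * deriv z x) has_real_derivative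
      a * (q x - p1 x * deriv y x - p2 x * y x) + b * (r x - p1 x * deriv z x - p2 x * z x)) (at x)"
    by (auto intro!: derivative_eq_intros D)
qed (simp add: algebra_simps)

text \<open>The energy \<open>u\<^sup>2 + u'\<^sup>2\<close> has derivative \<open>2 u u' - 2 p1 u'\<^sup>2 - 2 p2 u u'\<close>, which is
  at most a continuous multiple of the energy because \<open>2 \<bar>u u'\<bar> \<le> u\<^sup>2 + u'\<^sup>2\<close>.\<close>

lemma homogeneous_zero_initial_values:
  assumes I: "open I" "is_interval I" and p: "continuous_on I p1" "continuous_on I p2"
    and u: "solves_ode2 I p1 p2 (\<lambda>_. 0) u"
    and x0: "x0 \<in> I" "u x0 = 0" "deriv u x0 = 0" and x: "x \<in> I"
  shows "u x = 0"
proof -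
  define E where "E x = (u x)\<^sup>2 + (deriv u x)\<^sup>2" for x
  define E' where "E' x = 2 * (u x * deriv u x) * (1 - p2 x) - 2 * p1 x * (deriv u x)\<^sup>2" for x
  define k where "k x = 1 + \<bar>p2 x\<bar> + 2 * \<bar>p1 x\<bar>" for x
  have "E x = 0"
  proof (rule Gronwall_zero[OF I, where E = E and E' = E' and k = k and ?x0.0 = x0])
    show "continuous_on I k"
      unfolding k_def by (intro continuous_intros p)
    show "E x0 = 0" using x0 by (simp add: E_def)
    fix t assume t: "t \<in> I"
    show "0 \<le> E t" by (simp add: E_def)
    show "(E has_real_derivative E' t) (at t)"
      unfolding E_def[abs_def] E'_def
      by (auto intro!: derivative_eq_intros solves_ode2_derivs[OF I(1) u t]
          simp: algebra_simps power2_eq_square)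
    have uu: "\<bar>2 * (u t * deriv u t)\<bar> \<le> E t"
      using sum_squares_bound[of "u t" "deriv u t"] sum_squares_bound[of "u t" "- deriv u t"]
      by (auto simp: E_def abs_if)
    have "\<bar>E' t\<bar> \<le> \<bar>2 * (u t * deriv u t)\<bar> * \<bar>1 - p2 t\<bar> + 2 * \<bar>p1 t\<bar> * (deriv u t)\<^sup>2"
      unfolding E'_def by (rule order_trans[OF abs_triangle_ineq4]) (simp add: abs_mult)
    also have "\<dots> \<le> E t * (1 + \<bar>p2 t\<bar>) + 2 * \<bar>p1 t\<bar> * E t"
      by (intro add_mono mult_mono uu) (auto simp: E_def)
    also have "\<dots> = k t * E t" by (simp add: k_def algebra_simps)
    finally show "\<bar>E' t\<bar> \<le> k t * E t" .
  qed (use x0 x in auto)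
  then show ?thesis by (simp add: E_def)
qed

section \<open>A fundamental pair of solutions\<close>

locale fundamental_pair =
  fixes I :: "real set" and p1 p2 y1 y2 :: "real \<Rightarrow> real"
  assumes I: "open I" "is_interval I"
    and p: "continuous_on I p1" "continuous_on I p2"
    and y1: "solves_ode2 I p1 p2 (\<lambda>_. 0) y1" and y2: "solves_ode2 I p1 p2 (\<lambda>_. 0) y2"
    and indep: "lin_indep_on I y1 y2"
begin

abbreviation W :: "real \<Rightarrow> real" where "W \<equiv> wronskian y1 y2"

lemma homogeneous_lincomb: "solves_ode2 I p1 p2 (\<lambda>_. 0) (\<lambda>x. a * y1 x + b * y2 x)"
  using solves_ode2_lincomb[OF I(1) y1 y2, of a b] by simp

lemma deriv_lincomb:
  assumes "x \<in> I"
  shows "deriv (\<lambda>x. a * y1 x + b * y2 x) x = a * deriv y1 x + b * deriv y2 x"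
  by (rule DERIV_imp_deriv)
    (auto intro!: derivative_eq_intros solves_ode2_derivs[OF I(1) y1 assms]
      solves_ode2_derivs[OF I(1) y2 assms])

text \<open>If \<open>W\<close> vanished at \<open>x\<close>, the vectors \<open>(y1 x, y1' x)\<close> and \<open>(y2 x, y2' x)\<close> would be
  dependent, so a nontrivial combination of \<open>y1\<close> and \<open>y2\<close> would have zero initial values at \<open>x\<close>
  and hence vanish on \<open>I\<close>.\<close>

lemma wronskian_nonzero:
  assumes x: "x \<in> I"
  shows "W x \<noteq> 0"
proof
  assume W0: "W x = 0"
  have trivial: "a = 0 \<and> b = 0"
    if "a * y1 x + b * y2 x = 0" "a * deriv y1 x + b * deriv y2 x = 0" for a b
  proof -
    have "a * y1 t + b * y2 t = 0" if "t \<in> I" for t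
      by (rule homogeneous_zero_initial_values[OF I p homogeneous_lincomb x _ _ that])
        (use \<open>a * y1 x + b * y2 x = 0\<close> \<open>a * deriv y1 x + b * deriv y2 x = 0\<close> in
          \<open>simp_all add: deriv_lincomb[OF x]\<close>)
    then show ?thesis using indep unfolding lin_indep_on_def by blast
  qed
  have "y1 x = 0"
    using trivial[of "y2 x" "- y1 x"] W0 by (simp add: wronskian_def algebra_simps)
  moreover have "deriv y1 x = 0"
    using trivial[of "deriv y2 x" "- deriv y1 x"] W0 by (simp add: wronskian_def algebra_simps)
  ultimately show False using trivial[of 1 0] by simp
qed

lemma homogeneous_span:
  assumes u: "solves_ode2 I p1 p2 (\<lambda>_. 0) u"
  shows "\<exists>a b. \<forall>x\<in>I. u x = a * y1 x + b * y2 x"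
proof (cases "I = {}")
  case False
  then obtain x0 where x0: "x0 \<in> I" by blast
  define a where "a = (u x0 * deriv y2 x0 - deriv u x0 * y2 x0) / W x0"
  define b where "b = (y1 x0 * deriv u x0 - deriv y1 x0 * u x0) / W x0"
  \<comment> \<open>Cramer's rule: \<open>a y1 + b y2\<close> has the same value and slope as \<open>u\<close> at \<open>x0\<close>.\<close>
  have W0: "W x0 \<noteq> 0" by (rule wronskian_nonzero[OF x0])
  have val: "a * y1 x0 + b * y2 x0 = u x0" "a * deriv y1 x0 + b * deriv y2 x0 = deriv u x0"
  proof -
    have "(u x0 * deriv y2 x0 - deriv u x0 * y2 x0) * y1 x0 +
        (y1 x0 * deriv u x0 - deriv y1 x0 * u x0) * y2 x0 = u x0 * W x0"
      "(u x0 * deriv y2 x0 - deriv u x0 * y2 x0) * deriv y1 x0 +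
        (y1 x0 * deriv u x0 - deriv y1 x0 * u x0) * deriv y2 x0 = deriv u x0 * W x0"
      by (simp_all add: wronskian_def algebra_simps)
    then show "a * y1 x0 + b * y2 x0 = u x0" "a * deriv y1 x0 + b * deriv y2 x0 = deriv u x0"
      using W0 by (simp_all add: a_def b_def add_divide_distrib[symmetric])
  qed
  let ?d = "\<lambda>x. 1 * u x + (-1) * (a * y1 x + b * y2 x)"
  have d: "solves_ode2 I p1 p2 (\<lambda>_. 0) ?d"
    using solves_ode2_lincomb[OF I(1) u homogeneous_lincomb[of a b], of 1 "-1"] by simp
  have "deriv ?d x0 = deriv u x0 - (a * deriv y1 x0 + b * deriv y2 x0)"
    by (rule DERIV_imp_deriv)
      (auto intro!: derivative_eq_intros solves_ode2_derivs[OF I(1) y1 x0]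
        solves_ode2_derivs[OF I(1) y2 x0] solves_ode2_derivs[OF I(1) u x0])
  then have "\<forall>x\<in>I. ?d x = 0"
    using homogeneous_zero_initial_values[OF I p d x0] val by auto
  then have "\<forall>x\<in>I. u x = a * y1 x + b * y2 x" by (simp add: algebra_simps)
  then show ?thesis by blast
qed simp

lemma general_solution:
  assumes yp: "solves_ode2 I p1 p2 q yp"
  shows "solves_ode2 I p1 p2 q y \<longleftrightarrow> (\<exists>a b. \<forall>x\<in>I. y x = a * y1 x + b * y2 x + yp x)"
proof
  assume y: "solves_ode2 I p1 p2 q y"
  have "solves_ode2 I p1 p2 (\<lambda>_. 0) (\<lambda>x. 1 * y x + (-1) * yp x)"
    using solves_ode2_lincomb[OF I(1) y yp, of 1 "-1"] by simp
  from homogeneous_span[OF this] show "\<exists>a b. \<forall>x\<in>I. y x = a * y1 x + b * y2 x + yp x"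
    by (auto simp: algebra_simps)
next
  assume "\<exists>a b. \<forall>x\<in>I. y x = a * y1 x + b * y2 x + yp x"
  then obtain a b where ab: "\<And>x. x \<in> I \<Longrightarrow> y x = a * y1 x + b * y2 x + yp x" by blast
  show "solves_ode2 I p1 p2 q y"
    by (rule solves_ode2_cong[OF I(1) _ _
          solves_ode2_lincomb[OF I(1) homogeneous_lincomb[of a b] yp, of 1 1]]) (auto simp: ab)
qed

text \<open>Abel's identity \<open>W' = - p1 W\<close> makes the term \<open>p1 y / W\<close> appear; it is what will absorb the
  term \<open>p1 A\<close> of the modified system.\<close>

lemma quotient_deriv:
  assumes y: "solves_ode2 I p1 p2 (\<lambda>_. 0) y" and x: "x \<in> I"
  shows "((\<lambda>x. y x / W x) has_real_derivative deriv y x / W x + y x / W x * p1 x) (at x)"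
proof -
  note D1 = solves_ode2_derivs[OF I(1) y1 x]
  note D2 = solves_ode2_derivs[OF I(1) y2 x]
  have "(W has_real_derivative - p1 x * W x) (at x)"
    unfolding wronskian_def[abs_def]
    by (auto intro!: derivative_eq_intros D1 D2 simp: algebra_simps)
  then show ?thesis
    using wronskian_nonzero[OF x]
    by (auto intro!: derivative_eq_intros solves_ode2_derivs(1)[OF I(1) y x] simp: field_simps)
qed

lemma antiderivative_quotient_times:
  assumes A: "A differentiable_on I" and y: "solves_ode2 I p1 p2 (\<lambda>_. 0) y"
  shows "antiderivative_on I
    (\<lambda>s. y s / W s * deriv A s + y s / W s * p1 s * A s + deriv y s / W s * A s)
    (\<lambda>x. y x / W x * A x)"
  unfolding antiderivative_on_def
proof
  fix x assume x: "x \<in> I"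
  have "(A has_real_derivative deriv A x) (at x)"
    using A x I(1) by (simp add: DERIV_deriv_iff_real_differentiable
        differentiable_on_eq_differentiable_at)
  then show "((\<lambda>x. y x / W x * A x) has_real_derivative
      y x / W x * deriv A x + y x / W x * p1 x * A x + deriv y x / W x * A x) (at x)"
    using DERIV_mult[OF quotient_deriv[OF y x], of A "deriv A x"] by (simp add: algebra_simps)
qed

section \<open>Indefinite integrals of the kernels\<close>

text \<open>The two factors of a kernel are determined by it because \<open>y1\<close> and \<open>y2\<close> are linearly
  independent in \<open>x\<close>, for each fixed \<open>s\<close>.  The signs are chosen so that, for all the kernels
  below, \<open>f\<close> arises from \<open>y2\<close> in the way in which \<open>g\<close> arises from \<open>y1\<close>: by multiplying
  \<open>y / W\<close> or \<open>y' / W\<close> by a common factor.\<close>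

lemma indef_integral_iff:
  assumes k: "\<And>x s. x \<in> I \<Longrightarrow> s \<in> I \<Longrightarrow> k x s = y2 x * g s - y1 x * f s"
  shows "indef_integral I y1 y2 k J \<longleftrightarrow>
    (\<exists>F G. antiderivative_on I f F \<and> antiderivative_on I g G \<and>
       (\<forall>x\<in>I. J x = y2 x * G x - y1 x * F x))"
proof
  assume "indef_integral I y1 y2 k J"
  then obtain f' g' F' G' where k': "\<And>x s. x \<in> I \<Longrightarrow> s \<in> I \<Longrightarrow> k x s = y1 x * f' s + y2 x * g' s"
    and F': "antiderivative_on I f' F'" and G': "antiderivative_on I g' G'"
    and J: "\<And>x. x \<in> I \<Longrightarrow> J x = y1 x * F' x + y2 x * G' x"
    unfolding indef_integral_def by blast
  have same: "f' s + f s = 0 \<and> g' s - g s = 0" if s: "s \<in> I" for s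
  proof -
    have "\<forall>x\<in>I. (f' s + f s) * y1 x + (g' s - g s) * y2 x = 0"
      using k s k' by (simp add: algebra_simps)
    then show ?thesis using indep unfolding lin_indep_on_def by blast
  qed
  have "antiderivative_on I f (\<lambda>x. - F' x)"
    unfolding antiderivative_on_def
  proof
    fix x assume x: "x \<in> I"
    then have "((\<lambda>x. - F' x) has_real_derivative - f' x) (at x)"
      using F' unfolding antiderivative_on_def by (auto intro!: derivative_intros)
    moreover have "- f' x = f x" using same[OF x] by linarith
    ultimately show "((\<lambda>x. - F' x) has_real_derivative f x) (at x)" by simp
  qed
  moreover have "antiderivative_on I g G'"
    by (rule antiderivative_on_cong[OF _ G']) (use same in auto)
  moreover have "\<forall>x\<in>I. J x = y2 x * G' x - y1 x * (- F' x)"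
    using J by simp
  ultimately show "\<exists>F G. antiderivative_on I f F \<and> antiderivative_on I g G \<and>
       (\<forall>x\<in>I. J x = y2 x * G x - y1 x * F x)" by blast
next
  assume "\<exists>F G. antiderivative_on I f F \<and> antiderivative_on I g G \<and>
       (\<forall>x\<in>I. J x = y2 x * G x - y1 x * F x)"
  then obtain F G where F: "antiderivative_on I f F" and G: "antiderivative_on I g G"
    and J: "\<And>x. x \<in> I \<Longrightarrow> J x = y2 x * G x - y1 x * F x" by blast
  have "antiderivative_on I (\<lambda>s. - f s) (\<lambda>x. - F x)"
    using F unfolding antiderivative_on_def by (auto intro!: derivative_intros)
  then show "indef_integral I y1 y2 k J"
    unfolding indef_integral_def using G J k
    by (intro exI[of _ "\<lambda>s. - f s"] exI[of _ g] exI[of _ "\<lambda>x. - F x"] exI[of _ G]) auto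
qed

lemma indef_integral_add_lincomb:
  assumes "indef_integral I y1 y2 k J"
    and "\<And>x. x \<in> I \<Longrightarrow> J' x = J x + (a * y1 x + b * y2 x)"
  shows "indef_integral I y1 y2 k J'"
proof -
  obtain f g F G where k: "\<forall>x\<in>I. \<forall>s\<in>I. k x s = y1 x * f s + y2 x * g s"
    and FG: "antiderivative_on I f F" "antiderivative_on I g G"
    and J: "\<And>x. x \<in> I \<Longrightarrow> J x = y1 x * F x + y2 x * G x"
    using assms(1) unfolding indef_integral_def by blast
  show ?thesis
    unfolding indef_integral_def
    using k antiderivative_on_add_const[OF FG(1), of a] antiderivative_on_add_const[OF FG(2), of b]
    by (intro exI[of _ f] exI[of _ g] exI[of _ "\<lambda>x. F x + a"] exI[of _ "\<lambda>x. G x + b"])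
      (auto simp: assms(2) J algebra_simps)
qed

lemma vp_kernel_split:
  "vp_kernel y1 y2 x s * r s = y2 x * (y1 s / W s * r s) - y1 x * (y2 s / W s * r s)"
  by (simp add: vp_kernel_def diff_divide_distrib algebra_simps)

lemma vp_kernel_A_split:
  "vp_kernel_A y1 y2 x s * r s =
    y2 x * (deriv y1 s / W s * r s) - y1 x * (deriv y2 s / W s * r s)"
  by (simp add: vp_kernel_A_def diff_divide_distrib algebra_simps)

lemma indef_integral_vp_kernel_iff:
  "indef_integral I y1 y2 (\<lambda>x s. vp_kernel y1 y2 x s * r s) J \<longleftrightarrow>
    (\<exists>F G. antiderivative_on I (\<lambda>s. y2 s / W s * r s) F \<and>
       antiderivative_on I (\<lambda>s. y1 s / W s * r s) G \<and>
       (\<forall>x\<in>I. J x = y2 x * G x - y1 x * F x))"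
  by (rule indef_integral_iff) (rule vp_kernel_split)

lemma indef_integral_vp_kernel_p1_iff:
  "indef_integral I y1 y2 (\<lambda>x s. vp_kernel y1 y2 x s * p1 s * A s) J \<longleftrightarrow>
    (\<exists>F G. antiderivative_on I (\<lambda>s. y2 s / W s * p1 s * A s) F \<and>
       antiderivative_on I (\<lambda>s. y1 s / W s * p1 s * A s) G \<and>
       (\<forall>x\<in>I. J x = y2 x * G x - y1 x * F x))"
  using indef_integral_vp_kernel_iff[of "\<lambda>s. p1 s * A s" J] by (simp add: mult.assoc)

lemma indef_integral_vp_kernel_A_iff:
  "indef_integral I y1 y2 (\<lambda>x s. vp_kernel_A y1 y2 x s * A s) J \<longleftrightarrow>
    (\<exists>F G. antiderivative_on I (\<lambda>s. deriv y2 s / W s * A s) F \<and>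
       antiderivative_on I (\<lambda>s. deriv y1 s / W s * A s) G \<and>
       (\<forall>x\<in>I. J x = y2 x * G x - y1 x * F x))"
  by (rule indef_integral_iff) (rule vp_kernel_A_split)

lemma continuous_on_quotients:
  assumes y: "solves_ode2 I p1 p2 (\<lambda>_. 0) y"
  shows "continuous_on I (\<lambda>s. y s / W s)" "continuous_on I (\<lambda>s. deriv y s / W s)"
proof -
  have cont: "continuous_on I f" if "\<And>x. x \<in> I \<Longrightarrow> (f has_real_derivative f' x) (at x)" for f f'
    by (meson that DERIV_isCont continuous_at_imp_continuous_on)
  have c: "continuous_on I u" "continuous_on I (deriv u)" if "solves_ode2 I p1 p2 (\<lambda>_. 0) u" for u
    by (rule cont, erule solves_ode2_derivs[OF I(1) that])+
  have "continuous_on I W"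
    unfolding wronskian_def[abs_def] by (intro continuous_intros c y1 y2)
  then show "continuous_on I (\<lambda>s. y s / W s)" "continuous_on I (\<lambda>s. deriv y s / W s)"
    using wronskian_nonzero by (auto intro!: continuous_intros c[OF y])
qed

lemma indef_integral_vp_kernel_exists:
  assumes "continuous_on I q"
  shows "\<exists>J. indef_integral I y1 y2 (\<lambda>x s. vp_kernel y1 y2 x s * q s) J"
proof -
  obtain F G where "antiderivative_on I (\<lambda>s. y2 s / W s * q s) F"
      "antiderivative_on I (\<lambda>s. y1 s / W s * q s) G"
    using antiderivative_on_exists[OF I continuous_on_mult[OF continuous_on_quotients(1) assms]]
      y1 y2 by blast
  then show ?thesis
    unfolding indef_integral_vp_kernel_iff
    by (intro exI[of _ "\<lambda>x. y2 x * G x - y1 x * F x"] exI[of _ F] exI[of _ G]) simp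
qed

section \<open>The terms depending on the arbitrary function\<close>

text \<open>As \<open>A'\<close> need not be continuous, the antiderivative of \<open>y / W A'\<close> is obtained by parts: it is
  chosen as \<open>y / W A\<close> minus antiderivatives of the two continuous remaining terms.  This choice
  also fixes the constants of integration so that the sum is \<open>y / W A\<close> exactly.\<close>

lemma A_antiderivatives_exist:
  assumes A: "A differentiable_on I" and y: "solves_ode2 I p1 p2 (\<lambda>_. 0) y"
  obtains F1 F2 F3 where "antiderivative_on I (\<lambda>s. y s / W s * deriv A s) F1"
    "antiderivative_on I (\<lambda>s. y s / W s * p1 s * A s) F2"
    "antiderivative_on I (\<lambda>s. deriv y s / W s * A s) F3"
    "\<And>x. F1 x + F2 x + F3 x = y x / W x * A x"
proof -
  note cA = differentiable_imp_continuous_on[OF A]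
  note c = continuous_on_quotients[OF y]
  obtain F2 where F2: "antiderivative_on I (\<lambda>s. y s / W s * p1 s * A s) F2"
    using antiderivative_on_exists[OF I] continuous_on_mult[OF continuous_on_mult[OF c(1) p(1)] cA]
    by blast
  obtain F3 where F3: "antiderivative_on I (\<lambda>s. deriv y s / W s * A s) F3"
    using antiderivative_on_exists[OF I] continuous_on_mult[OF c(2) cA] by blast
  have F1: "antiderivative_on I (\<lambda>s. y s / W s * deriv A s) (\<lambda>x. y x / W x * A x - F2 x - F3 x)"
    by (rule antiderivative_on_cong[OF _ antiderivative_on_diff[OF antiderivative_on_diff
            [OF antiderivative_quotient_times[OF A y] F2] F3]]) simp
  show thesis by (rule that[OF F1 F2 F3]) simp
qed

text \<open>The cancellation behind the vanishing contribution: the three sums of antiderivatives are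
  \<open>y1 / W A\<close> and \<open>y2 / W A\<close>, and \<open>y2 (y1 / W A) - y1 (y2 / W A) = 0\<close>.\<close>

lemma A_terms_zero_exists:
  assumes A: "A differentiable_on I"
  shows "\<exists>J1 J2 J3. indef_integral I y1 y2 (\<lambda>x s. vp_kernel y1 y2 x s * deriv A s) J1 \<and>
        indef_integral I y1 y2 (\<lambda>x s. vp_kernel y1 y2 x s * p1 s * A s) J2 \<and>
        indef_integral I y1 y2 (\<lambda>x s. vp_kernel_A y1 y2 x s * A s) J3 \<and>
        (\<forall>x\<in>I. - J1 x - J2 x - J3 x = 0)"
proof -
  obtain F1 F2 F3 where F: "antiderivative_on I (\<lambda>s. y2 s / W s * deriv A s) F1"
    "antiderivative_on I (\<lambda>s. y2 s / W s * p1 s * A s) F2"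
    "antiderivative_on I (\<lambda>s. deriv y2 s / W s * A s) F3"
    and sF: "\<And>x. F1 x + F2 x + F3 x = y2 x / W x * A x"
    by (rule A_antiderivatives_exist[OF A y2]) blast
  obtain G1 G2 G3 where G: "antiderivative_on I (\<lambda>s. y1 s / W s * deriv A s) G1"
    "antiderivative_on I (\<lambda>s. y1 s / W s * p1 s * A s) G2"
    "antiderivative_on I (\<lambda>s. deriv y1 s / W s * A s) G3"
    and sG: "\<And>x. G1 x + G2 x + G3 x = y1 x / W x * A x"
    by (rule A_antiderivatives_exist[OF A y1]) blast
  let ?J = "\<lambda>G F x. y2 x * G x - y1 x * F x :: real"
  have "- ?J G1 F1 x - ?J G2 F2 x - ?J G3 F3 x = 0" for x
  proof -
    have "- ?J G1 F1 x - ?J G2 F2 x - ?J G3 F3 x =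
        y1 x * (F1 x + F2 x + F3 x) - y2 x * (G1 x + G2 x + G3 x)"
      by (simp add: algebra_simps)
    then show ?thesis by (simp add: sF sG)
  qed
  then show ?thesis
    unfolding indef_integral_vp_kernel_iff indef_integral_vp_kernel_p1_iff
      indef_integral_vp_kernel_A_iff
    using F G by (intro exI[of _ "?J G1 F1"] exI[of _ "?J G2 F2"] exI[of _ "?J G3 F3"]) blast
qed

lemma A_terms_homogeneous:
  assumes A: "A differentiable_on I"
    and J: "indef_integral I y1 y2 (\<lambda>x s. vp_kernel y1 y2 x s * deriv A s) J1"
      "indef_integral I y1 y2 (\<lambda>x s. vp_kernel y1 y2 x s * p1 s * A s) J2"
      "indef_integral I y1 y2 (\<lambda>x s. vp_kernel_A y1 y2 x s * A s) J3"
  shows "\<exists>a b. \<forall>x\<in>I. - J1 x - J2 x - J3 x = a * y1 x + b * y2 x"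
proof -
  have sum_eq: "\<exists>c. \<forall>x\<in>I. F1 x + F2 x + F3 x = y x / W x * A x + c"
    if "solves_ode2 I p1 p2 (\<lambda>_. 0) y" "antiderivative_on I (\<lambda>s. y s / W s * deriv A s) F1"
      "antiderivative_on I (\<lambda>s. y s / W s * p1 s * A s) F2"
      "antiderivative_on I (\<lambda>s. deriv y s / W s * A s) F3" for y F1 F2 F3
    by (rule antiderivative_on_diff_const[OF I(2)
          antiderivative_on_add[OF antiderivative_on_add[OF that(2,3)] that(4)]
          antiderivative_quotient_times[OF A that(1)]])
  obtain F1 G1 where 1: "antiderivative_on I (\<lambda>s. y2 s / W s * deriv A s) F1"
    "antiderivative_on I (\<lambda>s. y1 s / W s * deriv A s) G1"
    "\<And>x. x \<in> I \<Longrightarrow> J1 x = y2 x * G1 x - y1 x * F1 x"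
    using J(1) unfolding indef_integral_vp_kernel_iff by blast
  obtain F2 G2 where 2: "antiderivative_on I (\<lambda>s. y2 s / W s * p1 s * A s) F2"
    "antiderivative_on I (\<lambda>s. y1 s / W s * p1 s * A s) G2"
    "\<And>x. x \<in> I \<Longrightarrow> J2 x = y2 x * G2 x - y1 x * F2 x"
    using J(2) unfolding indef_integral_vp_kernel_p1_iff by blast
  obtain F3 G3 where 3: "antiderivative_on I (\<lambda>s. deriv y2 s / W s * A s) F3"
    "antiderivative_on I (\<lambda>s. deriv y1 s / W s * A s) G3"
    "\<And>x. x \<in> I \<Longrightarrow> J3 x = y2 x * G3 x - y1 x * F3 x"
    using J(3) unfolding indef_integral_vp_kernel_A_iff by blast
  obtain a where a: "\<And>x. x \<in> I \<Longrightarrow> F1 x + F2 x + F3 x = y2 x / W x * A x + a"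
    using sum_eq[OF y2 1(1) 2(1) 3(1)] by blast
  obtain b where b: "\<And>x. x \<in> I \<Longrightarrow> G1 x + G2 x + G3 x = y1 x / W x * A x + b"
    using sum_eq[OF y1 1(2) 2(2) 3(2)] by blast
  have "- J1 x - J2 x - J3 x = a * y1 x + (- b) * y2 x" if x: "x \<in> I" for x
  proof -
    have "- J1 x - J2 x - J3 x = y1 x * (F1 x + F2 x + F3 x) - y2 x * (G1 x + G2 x + G3 x)"
      unfolding 1(3)[OF x] 2(3)[OF x] 3(3)[OF x] by (simp add: algebra_simps)
    also have "\<dots> = y1 x * (y2 x / W x * A x + a) - y2 x * (y1 x / W x * A x + b)"
      unfolding a[OF x] b[OF x] ..
    finally show ?thesis by (simp add: algebra_simps)
  qed
  then show ?thesis by blast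
qed

section \<open>Variation of parameters with an arbitrary constraint\<close>

text \<open>For \<open>y = c1 y1 + c2 y2\<close> the constraint makes \<open>y' = A + c1 y1' + c2 y2'\<close>.  This can be
  differentiated once more although \<open>c1'\<close> and \<open>c2'\<close> need not be differentiable, and the terms
  with undifferentiated coefficients drop out by the homogeneous equation.\<close>

lemma constraint_imp_solves_iff:
  assumes A: "A differentiable_on I"
    and c: "c1 differentiable_on I" "c2 differentiable_on I"
    and con: "\<And>x. x \<in> I \<Longrightarrow> deriv c1 x * y1 x + deriv c2 x * y2 x = A x"
  shows "solves_ode2 I p1 p2 q (\<lambda>x. c1 x * y1 x + c2 x * y2 x) \<longleftrightarrow>
    (\<forall>x\<in>I. deriv y1 x * deriv c1 x + deriv y2 x * deriv c2 x = q x - (deriv A x + p1 x * A x))"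
proof -
  let ?y = "\<lambda>x. c1 x * y1 x + c2 x * y2 x"
  let ?r = "\<lambda>x. deriv y1 x * deriv c1 x + deriv y2 x * deriv c2 x + deriv A x + p1 x * A x"
  have D: "(f has_real_derivative deriv f x) (at x)" if "f differentiable_on I" "x \<in> I" for f x
    using that I(1) by (simp add: DERIV_deriv_iff_real_differentiable
        differentiable_on_eq_differentiable_at)
  have r: "solves_ode2 I p1 p2 ?r ?y"
    unfolding solves_ode2_iff[OF I(1)]
  proof (intro exI ballI conjI)
    fix x assume x: "x \<in> I"
    note Ds = D[OF c(1) x] D[OF c(2) x] D[OF A x] solves_ode2_derivs[OF I(1) y1 x]
      solves_ode2_derivs[OF I(1) y2 x]
    show "(?y has_real_derivative A x + c1 x * deriv y1 x + c2 x * deriv y2 x) (at x)"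
      using con[OF x] by (auto intro!: derivative_eq_intros Ds simp: algebra_simps)
    show "((\<lambda>x. A x + c1 x * deriv y1 x + c2 x * deriv y2 x) has_real_derivative
        deriv A x + deriv c1 x * deriv y1 x + c1 x * (0 - p1 x * deriv y1 x - p2 x * y1 x)
        + deriv c2 x * deriv y2 x + c2 x * (0 - p1 x * deriv y2 x - p2 x * y2 x)) (at x)"
      by (auto intro!: derivative_eq_intros Ds simp: algebra_simps)
  qed (simp add: algebra_simps)
  show ?thesis
  proof
    assume "solves_ode2 I p1 p2 q ?y"
    then show "\<forall>x\<in>I. deriv y1 x * deriv c1 x + deriv y2 x * deriv c2 x
        = q x - (deriv A x + p1 x * A x)"
      using r unfolding solves_ode2_def by (auto simp: algebra_simps)
  next
    assume *: "\<forall>x\<in>I. deriv y1 x * deriv c1 x + deriv y2 x * deriv c2 x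
        = q x - (deriv A x + p1 x * A x)"
    show "solves_ode2 I p1 p2 q ?y"
      by (rule solves_ode2_cong[OF I(1) _ _ r]) (use * in auto)
  qed
qed

lemma vp_coeffs_solves:
  assumes "A differentiable_on I" "vp_coeffs I p1 q y1 y2 A c1 c2"
  shows "solves_ode2 I p1 p2 q (\<lambda>x. c1 x * y1 x + c2 x * y2 x)"
  using constraint_imp_solves_iff[OF assms(1)] assms(2) unfolding vp_coeffs_def by blast

lemma Cramer_wronskian:
  assumes x: "x \<in> I"
  shows "d1 * y1 x + d2 * y2 x = A \<and> deriv y1 x * d1 + deriv y2 x * d2 = R \<longleftrightarrow>
    d1 = (R * y2 x - A * deriv y2 x) / (- W x) \<and> d2 = (R * y1 x - A * deriv y1 x) / W x"
    (is "?L \<longleftrightarrow> ?R")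
proof
  assume ?L
  then have e: "d1 * y1 x + d2 * y2 x = A" "deriv y1 x * d1 + deriv y2 x * d2 = R" by auto
  have "d1 * (- W x) = R * y2 x - A * deriv y2 x" "d2 * W x = R * y1 x - A * deriv y1 x"
    unfolding wronskian_def e[symmetric] by (simp_all add: algebra_simps)
  then show ?R using wronskian_nonzero[OF x] by (simp add: field_simps)
next
  assume ?R
  then have "d1 * W x = A * deriv y2 x - R * y2 x" "d2 * W x = R * y1 x - A * deriv y1 x"
    using wronskian_nonzero[OF x] by (simp_all add: field_simps)
  then have e: "W x * d1 = A * deriv y2 x - R * y2 x" "W x * d2 = R * y1 x - A * deriv y1 x"
    by (simp_all add: mult.commute)
  have "(d1 * y1 x + d2 * y2 x) * W x = (W x * d1) * y1 x + (W x * d2) * y2 x"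
    "(deriv y1 x * d1 + deriv y2 x * d2) * W x = deriv y1 x * (W x * d1) + deriv y2 x * (W x * d2)"
    by (simp_all add: algebra_simps)
  then have "(d1 * y1 x + d2 * y2 x) * W x = A * W x"
    "(deriv y1 x * d1 + deriv y2 x * d2) * W x = R * W x"
    unfolding e by (simp_all add: wronskian_def algebra_simps)
  then show ?L using wronskian_nonzero[OF x] by simp
qed

lemma vp_coeffs_iff_formulas:
  assumes "c1 differentiable_on I" "c2 differentiable_on I"
  shows "vp_coeffs I p1 q y1 y2 A c1 c2 \<longleftrightarrow>
    (\<forall>x\<in>I. deriv c1 x = ((q x - deriv A x - p1 x * A x) * y2 x - A x * deriv y2 x) / (- W x) \<and>
       deriv c2 x = ((q x - deriv A x - p1 x * A x) * y1 x - A x * deriv y1 x) / W x)"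
  using assms Cramer_wronskian unfolding vp_coeffs_def
  by (simp add: diff_diff_eq)

text \<open>By the derivative of \<open>y / W A\<close>, the formulas for the coefficients read
  \<open>c1' = (y2 / W A)' - y2 / W q\<close> and \<open>c2' = y1 / W q - (y1 / W A)'\<close>.\<close>

lemma vp_coeffs_iff_antiderivatives:
  assumes A: "A differentiable_on I"
  shows "vp_coeffs I p1 q y1 y2 A c1 c2 \<longleftrightarrow>
    antiderivative_on I (\<lambda>s. y2 s / W s * q s) (\<lambda>x. y2 x / W x * A x - c1 x) \<and>
    antiderivative_on I (\<lambda>s. y1 s / W s * q s) (\<lambda>x. c2 x + y1 x / W x * A x)"
proof -
  let ?T = "\<lambda>y s. y s / W s * deriv A s + y s / W s * p1 s * A s + deriv y s / W s * A s"
  let ?f1 = "\<lambda>x. ((q x - deriv A x - p1 x * A x) * y2 x - A x * deriv y2 x) / (- W x)"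
  let ?f2 = "\<lambda>x. ((q x - deriv A x - p1 x * A x) * y1 x - A x * deriv y1 x) / W x"
  note Q1 = antiderivative_quotient_times[OF A y1]
  note Q2 = antiderivative_quotient_times[OF A y2]
  have f1: "?f1 x = ?T y2 x - y2 x / W x * q x" and f2: "?f2 x = y1 x / W x * q x - ?T y1 x"
    if "x \<in> I" for x
    using wronskian_nonzero[OF that] by (simp_all add: field_simps)
  have "vp_coeffs I p1 q y1 y2 A c1 c2 \<longleftrightarrow> antiderivative_on I ?f1 c1 \<and> antiderivative_on I ?f2 c2"
    unfolding antiderivative_on_iff_deriv[OF I(1)]
    using vp_coeffs_iff_formulas[of c1 c2 q A] vp_coeffs_def by blast
  also have "antiderivative_on I ?f1 c1 \<longleftrightarrow>
      antiderivative_on I (\<lambda>s. y2 s / W s * q s) (\<lambda>x. y2 x / W x * A x - c1 x)" (is "?a \<longleftrightarrow> ?b")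
  proof
    assume ?a
    show ?b
      by (rule antiderivative_on_cong[OF _ antiderivative_on_diff[OF Q2 \<open>?a\<close>]])
        (simp add: f1 del: divide_minus_right)
  next
    assume ?b
    have "antiderivative_on I (\<lambda>s. ?T y2 s - y2 s / W s * q s) c1"
      using antiderivative_on_diff[OF Q2 \<open>?b\<close>] by simp
    then show ?a by (rule antiderivative_on_cong[rotated]) (rule f1[symmetric])
  qed
  also have "antiderivative_on I ?f2 c2 \<longleftrightarrow>
      antiderivative_on I (\<lambda>s. y1 s / W s * q s) (\<lambda>x. c2 x + y1 x / W x * A x)" (is "?a \<longleftrightarrow> ?b")
  proof
    assume ?a
    show ?b
      by (rule antiderivative_on_cong[OF _ antiderivative_on_add[OF \<open>?a\<close> Q1]])
        (simp add: f2)
  next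
    assume ?b
    have "antiderivative_on I (\<lambda>s. y1 s / W s * q s - ?T y1 s) c2"
      using antiderivative_on_diff[OF \<open>?b\<close> Q1] by simp
    then show ?a by (rule antiderivative_on_cong[rotated]) (rule f2[symmetric])
  qed
  finally show ?thesis .
qed

text \<open>The shifts by \<open>y2 / W A\<close> and \<open>- y1 / W A\<close> cancel in \<open>c1 y1 + c2 y2\<close>, which is why \<open>A\<close>
  has disappeared on the right.\<close>

lemma vp_solution_iff_indef_integral:
  assumes A: "A differentiable_on I"
  shows "(\<exists>c1 c2. vp_coeffs I p1 q y1 y2 A c1 c2 \<and> (\<forall>x\<in>I. yp x = c1 x * y1 x + c2 x * y2 x)) \<longleftrightarrow>
    indef_integral I y1 y2 (\<lambda>x s. vp_kernel y1 y2 x s * q s) yp"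
  unfolding indef_integral_vp_kernel_iff vp_coeffs_iff_antiderivatives[OF A]
proof
  assume "\<exists>c1 c2. (antiderivative_on I (\<lambda>s. y2 s / W s * q s) (\<lambda>x. y2 x / W x * A x - c1 x) \<and>
      antiderivative_on I (\<lambda>s. y1 s / W s * q s) (\<lambda>x. c2 x + y1 x / W x * A x)) \<and>
    (\<forall>x\<in>I. yp x = c1 x * y1 x + c2 x * y2 x)"
  then obtain c1 c2 where
    "antiderivative_on I (\<lambda>s. y2 s / W s * q s) (\<lambda>x. y2 x / W x * A x - c1 x)"
    "antiderivative_on I (\<lambda>s. y1 s / W s * q s) (\<lambda>x. c2 x + y1 x / W x * A x)"
    "\<forall>x\<in>I. yp x = c1 x * y1 x + c2 x * y2 x" by blast
  then show "\<exists>F G. antiderivative_on I (\<lambda>s. y2 s / W s * q s) F \<and>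
      antiderivative_on I (\<lambda>s. y1 s / W s * q s) G \<and> (\<forall>x\<in>I. yp x = y2 x * G x - y1 x * F x)"
    by (intro exI[of _ "\<lambda>x. y2 x / W x * A x - c1 x"] exI[of _ "\<lambda>x. c2 x + y1 x / W x * A x"])
      (simp add: algebra_simps)
next
  assume "\<exists>F G. antiderivative_on I (\<lambda>s. y2 s / W s * q s) F \<and>
      antiderivative_on I (\<lambda>s. y1 s / W s * q s) G \<and> (\<forall>x\<in>I. yp x = y2 x * G x - y1 x * F x)"
  then obtain F G where "antiderivative_on I (\<lambda>s. y2 s / W s * q s) F"
    "antiderivative_on I (\<lambda>s. y1 s / W s * q s) G"
    "\<forall>x\<in>I. yp x = y2 x * G x - y1 x * F x" by blast
  then show "\<exists>c1 c2. (antiderivative_on I (\<lambda>s. y2 s / W s * q s) (\<lambda>x. y2 x / W x * A x - c1 x) \<and>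
      antiderivative_on I (\<lambda>s. y1 s / W s * q s) (\<lambda>x. c2 x + y1 x / W x * A x)) \<and>
    (\<forall>x\<in>I. yp x = c1 x * y1 x + c2 x * y2 x)"
    by (intro exI[of _ "\<lambda>x. y2 x / W x * A x - F x"] exI[of _ "\<lambda>x. G x - y1 x / W x * A x"])
      (simp add: algebra_simps)
qed

lemma vp_solution_iff_integrated_form:
  assumes A: "A differentiable_on I"
  shows "(\<exists>c1 c2. vp_coeffs I p1 q y1 y2 A c1 c2 \<and> (\<forall>x\<in>I. yp x = c1 x * y1 x + c2 x * y2 x)) \<longleftrightarrow>
    (\<exists>Jq J1 J2 J3.
       indef_integral I y1 y2 (\<lambda>x s. vp_kernel y1 y2 x s * q s) Jq \<and>
       indef_integral I y1 y2 (\<lambda>x s. vp_kernel y1 y2 x s * deriv A s) J1 \<and>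
       indef_integral I y1 y2 (\<lambda>x s. vp_kernel y1 y2 x s * p1 s * A s) J2 \<and>
       indef_integral I y1 y2 (\<lambda>x s. vp_kernel_A y1 y2 x s * A s) J3 \<and>
       (\<forall>x\<in>I. yp x = Jq x - J1 x - J2 x - J3 x))" (is "_ \<longleftrightarrow> ?R")
  unfolding vp_solution_iff_indef_integral[OF A]
proof
  assume yp: "indef_integral I y1 y2 (\<lambda>x s. vp_kernel y1 y2 x s * q s) yp"
  obtain J1 J2 J3 where "indef_integral I y1 y2 (\<lambda>x s. vp_kernel y1 y2 x s * deriv A s) J1"
    "indef_integral I y1 y2 (\<lambda>x s. vp_kernel y1 y2 x s * p1 s * A s) J2"
    "indef_integral I y1 y2 (\<lambda>x s. vp_kernel_A y1 y2 x s * A s) J3"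
    and zero: "\<And>x. x \<in> I \<Longrightarrow> - J1 x - J2 x - J3 x = 0"
    using A_terms_zero_exists[OF A] by blast
  moreover have "yp x = yp x - J1 x - J2 x - J3 x" if "x \<in> I" for x
    using zero[OF that] by simp
  ultimately show ?R using yp by blast
next
  assume ?R
  then obtain Jq J1 J2 J3 where
    Jq: "indef_integral I y1 y2 (\<lambda>x s. vp_kernel y1 y2 x s * q s) Jq"
    and J: "indef_integral I y1 y2 (\<lambda>x s. vp_kernel y1 y2 x s * deriv A s) J1"
      "indef_integral I y1 y2 (\<lambda>x s. vp_kernel y1 y2 x s * p1 s * A s) J2"
      "indef_integral I y1 y2 (\<lambda>x s. vp_kernel_A y1 y2 x s * A s) J3"
    and yp: "\<And>x. x \<in> I \<Longrightarrow> yp x = Jq x - J1 x - J2 x - J3 x" by blast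
  obtain a b where ab: "\<And>x. x \<in> I \<Longrightarrow> - J1 x - J2 x - J3 x = a * y1 x + b * y2 x"
    using A_terms_homogeneous[OF A J] by blast
  show "indef_integral I y1 y2 (\<lambda>x s. vp_kernel y1 y2 x s * q s) yp"
  proof (rule indef_integral_add_lincomb[OF Jq])
    fix x assume "x \<in> I"
    then show "yp x = Jq x + (a * y1 x + b * y2 x)" using yp ab by fastforce
  qed
qed

lemma indef_integral_solves:
  assumes "indef_integral I y1 y2 (\<lambda>x s. vp_kernel y1 y2 x s * q s) J"
  shows "solves_ode2 I p1 p2 q J"
proof -
  have "(\<lambda>_. 0 :: real) differentiable_on I" by simp
  note zero = vp_solution_iff_indef_integral[OF this] vp_coeffs_solves[OF this]
  obtain c1 c2 where c: "vp_coeffs I p1 q y1 y2 (\<lambda>_. 0) c1 c2"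
    and J: "\<And>x. x \<in> I \<Longrightarrow> J x = c1 x * y1 x + c2 x * y2 x"
    using assms zero(1) by blast
  show ?thesis by (rule solves_ode2_cong[OF I(1) _ _ zero(2)[OF c]]) (simp_all add: J)
qed

end

section \<open>The generalised method of variation of parameters\<close>

theorem mainTheorem2:
  fixes I :: "real set" and p1 p2 q y1 y2 A :: "real \<Rightarrow> real"
  assumes "open I" and "is_interval I"
    and "continuous_on I p1" and "continuous_on I p2" and "continuous_on I q"
    and "\<exists>x\<in>I. q x \<noteq> 0"
    and "solves_ode2 I p1 p2 (\<lambda>_. 0) y1" and "solves_ode2 I p1 p2 (\<lambda>_. 0) y2"
    and "lin_indep_on I y1 y2"
    and "A differentiable_on I"
  shows
    \<comment> \<open>under the constraint with \<open>A\<close>, the differential equation becomes the second equation\<close>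
    "(\<forall>c1 c2. c1 differentiable_on I \<and> c2 differentiable_on I \<and>
        (\<forall>x\<in>I. deriv c1 x * y1 x + deriv c2 x * y2 x = A x) \<longrightarrow>
        (solves_ode2 I p1 p2 q (\<lambda>x. c1 x * y1 x + c2 x * y2 x) \<longleftrightarrow>
         (\<forall>x\<in>I. deriv y1 x * deriv c1 x + deriv y2 x * deriv c2 x
                  = q x - (deriv A x + p1 x * A x)))) \<and>
    \<comment> \<open>solving for \<open>c1'\<close> and \<open>c2'\<close>\<close>
     (\<forall>x\<in>I. wronskian y1 y2 x \<noteq> 0) \<and>
     (\<forall>c1 c2. c1 differentiable_on I \<and> c2 differentiable_on I \<longrightarrow>
        (vp_coeffs I p1 q y1 y2 A c1 c2 \<longleftrightarrow>
         (\<forall>x\<in>I. deriv c1 x = ((q x - deriv A x - p1 x * A x) * y2 x - A x * deriv y2 x)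
                                / (- wronskian y1 y2 x) \<and>
                 deriv c2 x = ((q x - deriv A x - p1 x * A x) * y1 x - A x * deriv y1 x)
                                / wronskian y1 y2 x))) \<and>
     (\<exists>c1 c2. vp_coeffs I p1 q y1 y2 A c1 c2) \<and>
     (\<forall>c1 c2. vp_coeffs I p1 q y1 y2 A c1 c2 \<longrightarrow>
        particular_integral I p1 p2 q (\<lambda>x. c1 x * y1 x + c2 x * y2 x)) \<and>
    \<comment> \<open>the integrated form of the particular solution\<close>
     (\<forall>yp. (\<exists>c1 c2. vp_coeffs I p1 q y1 y2 A c1 c2 \<and> (\<forall>x\<in>I. yp x = c1 x * y1 x + c2 x * y2 x)) \<longleftrightarrow>
        (\<exists>Jq J1 J2 J3.
           indef_integral I y1 y2 (\<lambda>x s. vp_kernel y1 y2 x s * q s) Jq \<and>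
           indef_integral I y1 y2 (\<lambda>x s. vp_kernel y1 y2 x s * deriv A s) J1 \<and>
           indef_integral I y1 y2 (\<lambda>x s. vp_kernel y1 y2 x s * p1 s * A s) J2 \<and>
           indef_integral I y1 y2 (\<lambda>x s. vp_kernel_A y1 y2 x s * A s) J3 \<and>
           (\<forall>x\<in>I. yp x = Jq x - J1 x - J2 x - J3 x))) \<and>
    \<comment> \<open>the terms depending on \<open>A\<close> and \<open>A'\<close> contribute zero, up to the constants of integration\<close>
     (\<exists>J1 J2 J3.
        indef_integral I y1 y2 (\<lambda>x s. vp_kernel y1 y2 x s * deriv A s) J1 \<and>
        indef_integral I y1 y2 (\<lambda>x s. vp_kernel y1 y2 x s * p1 s * A s) J2 \<and>
        indef_integral I y1 y2 (\<lambda>x s. vp_kernel_A y1 y2 x s * A s) J3 \<and>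
        (\<forall>x\<in>I. - J1 x - J2 x - J3 x = 0)) \<and>
     (\<forall>J1 J2 J3.
        indef_integral I y1 y2 (\<lambda>x s. vp_kernel y1 y2 x s * deriv A s) J1 \<and>
        indef_integral I y1 y2 (\<lambda>x s. vp_kernel y1 y2 x s * p1 s * A s) J2 \<and>
        indef_integral I y1 y2 (\<lambda>x s. vp_kernel_A y1 y2 x s * A s) J3 \<longrightarrow>
        (\<exists>a b. \<forall>x\<in>I. - J1 x - J2 x - J3 x = a * y1 x + b * y2 x)) \<and>
    \<comment> \<open>the conventional choice \<open>A = 0\<close> gives the same functions\<close>
     (\<forall>yp. (\<exists>c1 c2. vp_coeffs I p1 q y1 y2 A c1 c2 \<and> (\<forall>x\<in>I. yp x = c1 x * y1 x + c2 x * y2 x)) \<longleftrightarrow>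
        (\<exists>c1 c2. vp_coeffs I p1 q y1 y2 (\<lambda>_. 0) c1 c2 \<and> (\<forall>x\<in>I. yp x = c1 x * y1 x + c2 x * y2 x))) \<and>
    \<comment> \<open>the complete solution, as obtained with \<open>A\<close> and in the form free of \<open>A\<close>\<close>
     (\<forall>d1 d2. vp_coeffs I p1 q y1 y2 A d1 d2 \<longrightarrow>
        (\<forall>y. solves_ode2 I p1 p2 q y \<longleftrightarrow>
           (\<exists>c1 c2. \<forall>x\<in>I. y x = c1 * y1 x + c2 * y2 x + (d1 x * y1 x + d2 x * y2 x)))) \<and>
     (\<exists>Jq. indef_integral I y1 y2 (\<lambda>x s. vp_kernel y1 y2 x s * q s) Jq) \<and>
     (\<forall>Jq. indef_integral I y1 y2 (\<lambda>x s. vp_kernel y1 y2 x s * q s) Jq \<longrightarrow>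
        (\<forall>y. solves_ode2 I p1 p2 q y \<longleftrightarrow>
           (\<exists>c1 c2. \<forall>x\<in>I. y x = c1 * y1 x + c2 * y2 x + Jq x)))"
proof -
  interpret fundamental_pair I p1 p2 y1 y2
    using assms by unfold_locales
  note A = \<open>A differentiable_on I\<close>
  have zero: "(\<lambda>_. 0 :: real) differentiable_on I" by simp
  have ex: "\<exists>J. indef_integral I y1 y2 (\<lambda>x s. vp_kernel y1 y2 x s * q s) J"
    by (rule indef_integral_vp_kernel_exists) fact
  have part: "particular_integral I p1 p2 q (\<lambda>x. c1 x * y1 x + c2 x * y2 x)"
    if "vp_coeffs I p1 q y1 y2 A c1 c2" for c1 c2
  proof -
    note sol = vp_coeffs_solves[OF A that]
    obtain x where x: "x \<in> I" "q x \<noteq> 0" using \<open>\<exists>x\<in>I. q x \<noteq> 0\<close> by blast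
    have "\<not> solves_ode2 I p1 p2 (\<lambda>_. 0) (\<lambda>x. c1 x * y1 x + c2 x * y2 x)"
    proof
      assume "solves_ode2 I p1 p2 (\<lambda>_. 0) (\<lambda>x. c1 x * y1 x + c2 x * y2 x)"
      with sol have "q x = 0" using x(1) unfolding solves_ode2_def by fastforce
      then show False using x(2) by simp
    qed
    then show ?thesis using sol unfolding particular_integral_def by blast
  qed
  show ?thesis
  proof (intro conjI)
    show "\<forall>c1 c2. c1 differentiable_on I \<and> c2 differentiable_on I \<and>
        (\<forall>x\<in>I. deriv c1 x * y1 x + deriv c2 x * y2 x = A x) \<longrightarrow>
        (solves_ode2 I p1 p2 q (\<lambda>x. c1 x * y1 x + c2 x * y2 x) \<longleftrightarrow>
         (\<forall>x\<in>I. deriv y1 x * deriv c1 x + deriv y2 x * deriv c2 x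
                  = q x - (deriv A x + p1 x * A x)))"
      by (intro allI impI, elim conjE) (rule constraint_imp_solves_iff[OF A], auto)
    show "\<exists>c1 c2. vp_coeffs I p1 q y1 y2 A c1 c2"
      using ex vp_solution_iff_indef_integral[OF A] by blast
    show "\<forall>x\<in>I. wronskian y1 y2 x \<noteq> 0"
      using wronskian_nonzero by blast
    show "\<forall>c1 c2. c1 differentiable_on I \<and> c2 differentiable_on I \<longrightarrow>
        (vp_coeffs I p1 q y1 y2 A c1 c2 \<longleftrightarrow>
         (\<forall>x\<in>I. deriv c1 x = ((q x - deriv A x - p1 x * A x) * y2 x - A x * deriv y2 x)
                                / (- wronskian y1 y2 x) \<and>
                 deriv c2 x = ((q x - deriv A x - p1 x * A x) * y1 x - A x * deriv y1 x)
                                / wronskian y1 y2 x))"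
      by (intro allI impI, elim conjE) (rule vp_coeffs_iff_formulas)
    show "\<forall>c1 c2. vp_coeffs I p1 q y1 y2 A c1 c2 \<longrightarrow>
        particular_integral I p1 p2 q (\<lambda>x. c1 x * y1 x + c2 x * y2 x)"
      using part by blast
    show "\<forall>yp. (\<exists>c1 c2. vp_coeffs I p1 q y1 y2 A c1 c2 \<and> (\<forall>x\<in>I. yp x = c1 x * y1 x + c2 x * y2 x)) \<longleftrightarrow>
        (\<exists>c1 c2. vp_coeffs I p1 q y1 y2 (\<lambda>_. 0) c1 c2 \<and> (\<forall>x\<in>I. yp x = c1 x * y1 x + c2 x * y2 x))"
      unfolding vp_solution_iff_indef_integral[OF A] vp_solution_iff_indef_integral[OF zero] by simp
    show "\<forall>d1 d2. vp_coeffs I p1 q y1 y2 A d1 d2 \<longrightarrow>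
        (\<forall>y. solves_ode2 I p1 p2 q y \<longleftrightarrow>
           (\<exists>c1 c2. \<forall>x\<in>I. y x = c1 * y1 x + c2 * y2 x + (d1 x * y1 x + d2 x * y2 x)))"
      by (intro allI impI) (rule general_solution[OF vp_coeffs_solves[OF A]])
    show "\<forall>Jq. indef_integral I y1 y2 (\<lambda>x s. vp_kernel y1 y2 x s * q s) Jq \<longrightarrow>
        (\<forall>y. solves_ode2 I p1 p2 q y \<longleftrightarrow>
           (\<exists>c1 c2. \<forall>x\<in>I. y x = c1 * y1 x + c2 * y2 x + Jq x))"
      by (intro allI impI) (rule general_solution[OF indef_integral_solves])
    show "\<forall>yp. (\<exists>c1 c2. vp_coeffs I p1 q y1 y2 A c1 c2 \<and> (\<forall>x\<in>I. yp x = c1 x * y1 x + c2 x * y2 x)) \<longleftrightarrow>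
        (\<exists>Jq J1 J2 J3.
           indef_integral I y1 y2 (\<lambda>x s. vp_kernel y1 y2 x s * q s) Jq \<and>
           indef_integral I y1 y2 (\<lambda>x s. vp_kernel y1 y2 x s * deriv A s) J1 \<and>
           indef_integral I y1 y2 (\<lambda>x s. vp_kernel y1 y2 x s * p1 s * A s) J2 \<and>
           indef_integral I y1 y2 (\<lambda>x s. vp_kernel_A y1 y2 x s * A s) J3 \<and>
           (\<forall>x\<in>I. yp x = Jq x - J1 x - J2 x - J3 x))"
      by (intro allI) (rule vp_solution_iff_integrated_form[OF A])
    show "\<exists>J1 J2 J3.
        indef_integral I y1 y2 (\<lambda>x s. vp_kernel y1 y2 x s * deriv A s) J1 \<and>
        indef_integral I y1 y2 (\<lambda>x s. vp_kernel y1 y2 x s * p1 s * A s) J2 \<and>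
        indef_integral I y1 y2 (\<lambda>x s. vp_kernel_A y1 y2 x s * A s) J3 \<and>
        (\<forall>x\<in>I. - J1 x - J2 x - J3 x = 0)"
      by (rule A_terms_zero_exists[OF A])
    show "\<forall>J1 J2 J3.
        indef_integral I y1 y2 (\<lambda>x s. vp_kernel y1 y2 x s * deriv A s) J1 \<and>
        indef_integral I y1 y2 (\<lambda>x s. vp_kernel y1 y2 x s * p1 s * A s) J2 \<and>
        indef_integral I y1 y2 (\<lambda>x s. vp_kernel_A y1 y2 x s * A s) J3 \<longrightarrow>
        (\<exists>a b. \<forall>x\<in>I. - J1 x - J2 x - J3 x = a * y1 x + b * y2 x)"
      by (intro allI impI, elim conjE) (rule A_terms_homogeneous[OF A])
    show "\<exists>Jq. indef_integral I y1 y2 (\<lambda>x s. vp_kernel y1 y2 x s * q s) Jq"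
      by (rule ex)
  qed
qed

end
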